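(* The computation of the formula $$\mathcal{E}_4(\mu):=\tilde\beta_\mu^{-1}\left(\sum_{r=1}^{\hat\sigma}\lambda_r^{\hat\sigma}(\mu)V_r\right)^{1/2},\qquad \mu\in\mathcal{P}_{\rm trial},$$ where $\lambda^{\hat\sigma}(\mu)\in\mathbb{C}^{\hat\sigma}$ is the solution to $B^{\hat\sigma}\lambda^{\hat\sigma}(\mu)=q^{\hat\sigma}(\mu)$ and $V_r=\|G_{\mu_r}\hat u_{\mu_r}\|_{\mathcal{V}}^2$, is well defined (the linear system defining $\lambda^{\hat\sigma}(\mu)$ is uniquely solvable). Moreover, this formula is online-efficient: once the offline quantities have been precomputed, $\mathcal{E}_4(\mu)$ can be computed in the online stage in complexity independent of $N$.
   Context: **Reduced basis setting.** $\mathcal{V}$ is a complex inner product space of finite dimension $N$ with norm $\|\cdot\|_{\mathcal{V}}$. For $\mu$ in a parameter set $\mathcal{P}$, $a_\mu=\sum_{k=1}^d\alpha_k(\mu)a_k$ is an inf-sup stable bounded sesquilinear form on $\mathcal{V}\times\mathcal{V}$, with $\alpha_k:\mathcal{P}\to\mathbb{C}$ computable in complexity independent of $N$ and $a_k$ sesquilinear forms independent of $\mu$. $b$ is a continuous (antilinear) form on $\mathcal{V}$. $J:\mathcal{V}'\to\mathcal{V}$ is the Riesz isomorphism and $G_\mu u:=J(a_\mu(u,\cdot)-b)$. A reduced basis $u_1,\dots,u_{\hat N}\in\mathcal{V}$ is given, and the reduced solution $\hat u_\mu=\sum_{i=1}^{\hat N}\gamma_i(\mu)u_i$ solves $a_\mu(\hat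 u_\mu,u_j)=b(u_j)$ for $1\le j\le\hat N$; the matrices $(a_k(u_i,u_j))_{i,j}$ and the vector $(b(u_j))_j$ are precomputed offline. $\tilde\beta_\mu>0$ is a lower bound of the inf-sup constant of $a_\mu$, computable in complexity independent of $N$. The method has an offline stage (precomputations, whose cost may depend on $N$) and an online stage (evaluations for given $\mu$). **The vector to be interpolated.** Let $\sigma:=1+2d\hat N+(d\hat N)^2$ and let $\mathcal{P}_{\rm trial}\subset\mathcal{P}$ be finite. For $\mu\in\mathcal{P}_{\rm trial}$, $\hat X(\mu)\in\mathbb{C}^\sigma$ is the vector with components $(1,\hat x_I,\hat x_I^*,\hat x_I^*\hat x_J)_{1\le I,J\le d\hat N}$, where $\hat x_I=\alpha_k(\mu)\gamma_i(\mu)$ with $I=i+\hat N(k-1)$, $1\le i\le\hat N$, $1\le k\le d$, and $^*$ denotes complex conjugation. **Offline stage of the empirical interpolation method (EIM).** Fix $1<\hat\sigma\le\sigma$. Choose $p_1\in{\rm argmax}_{1\le p\le\sigma}\max_{\mu\in\mathcal{P}_{\rm trial}}|\hat X_p(\mu)|$, $\mu_1\in{\rm argmax}_{\mu\in\mathcal{P}_{\rm trial}}|\hat X_{p_1}(\mu)|$, and set $q_1(\cdot)=\hat X_{p_1}(\cdot)/\hat X_{p_1}(\mu_1)$, $B^1_{11}=1$. For $k=1,\dots,\hat\sigma-1$, successively: let $$(I^k\hat X)(\mu):=\sum_{r=1}^k\lambda_r^k(\mu)\hat X(\mu_r),\qquad B^k\lambda^k(\mu)=q^k(\mu):=(q_1(\mu),\dots,q_k(\mu))^t,$$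 and $\delta^k:={\rm Id}-I^k$; choose $p_{k+1}\in{\rm argmax}_{1\le p\le\sigma}\max_{\mu\in\mathcal{P}_{\rm trial}}|(\delta^k\hat X)_p(\mu)|$, $\mu_{k+1}\in{\rm argmax}_{\mu\in\mathcal{P}_{\rm trial}}|(\delta^k\hat X)_{p_{k+1}}(\mu)|$; set $$q_{k+1}(\cdot):=\frac{(\delta^k\hat X)_{p_{k+1}}(\cdot)}{(\delta^k\hat X)_{p_{k+1}}(\mu_{k+1})},\qquad B^{k+1}_{ij}:=q_i(\mu_j),\ 1\le i,j\le k+1 .$$ It is assumed that the denominators above are nonzero, so that the algorithm performs its $\hat\sigma$ steps. All computations are in exact arithmetic. The numbers $V_r=\|G_{\mu_r}\hat u_{\mu_r}\|_{\mathcal{V}}^2$, $1\le r\le\hat\sigma$, are precomputed offline. The power $1/2$ is a fixed (e.g. principal) branch of the complex square root.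
   Formalization: The reduced basis is assumed linearly independent and the reduced problem uniquely solvable for each parameter; inf-sup stability on the full space does not ensure this, and without it the coefficients of the reduced solution are not determined by the offline data. *)

theory Defs
  imports Complex_Main "Jordan_Normal_Form.Matrix"
begin

text \<open>All index ranges start at 0: the index \<open>i\<close> here is the index \<open>i + 1\<close> of the usual
  presentation of the reduced basis method and of the empirical interpolation method.\<close>

section \<open>Finite-dimensional complex inner product spaces and forms on them\<close>

text \<open>The space is a subset \<open>V\<close> of a type carrying a complex vector space structure, so that
  statements may quantify over spaces \<open>V\<close> of all dimensions \<open>N\<close>.\<close>

locale cinner_space = vector_space scale
  for scale :: "complex \<Rightarrow> 'v \<Rightarrow> 'v::ab_group_add" +
  fixes V :: "'v set" and ip :: "'v \<Rightarrow> 'v \<Rightarrow> complex" and N :: nat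
  assumes dimension: "\<exists>E. finite E \<and> independent E \<and> card E = N \<and> span E = V"
    and ip_add: "\<lbrakk>x \<in> V; y \<in> V; z \<in> V\<rbrakk> \<Longrightarrow> ip (x + y) z = ip x z + ip y z"
    and ip_scale: "\<lbrakk>x \<in> V; y \<in> V\<rbrakk> \<Longrightarrow> ip (scale c x) y = c * ip x y"
    and ip_commute: "\<lbrakk>x \<in> V; y \<in> V\<rbrakk> \<Longrightarrow> ip y x = cnj (ip x y)"
    and ip_pos: "\<lbrakk>x \<in> V; x \<noteq> 0\<rbrakk> \<Longrightarrow> 0 < Re (ip x x)"

definition cnorm :: "('v \<Rightarrow> 'v \<Rightarrow> complex) \<Rightarrow> 'v \<Rightarrow> real" where
  "cnorm ip x = sqrt (Re (ip x x))"

definition linear_form ::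
  "(complex \<Rightarrow> 'v \<Rightarrow> 'v::ab_group_add) \<Rightarrow> 'v set \<Rightarrow> ('v \<Rightarrow> complex) \<Rightarrow> bool" where
  "linear_form scale V f \<longleftrightarrow>
     (\<forall>x\<in>V. \<forall>y\<in>V. f (x + y) = f x + f y) \<and> (\<forall>c. \<forall>x\<in>V. f (scale c x) = c * f x)"

definition antilinear_form ::
  "(complex \<Rightarrow> 'v \<Rightarrow> 'v::ab_group_add) \<Rightarrow> 'v set \<Rightarrow> ('v \<Rightarrow> complex) \<Rightarrow> bool" where
  "antilinear_form scale V f \<longleftrightarrow>
     (\<forall>x\<in>V. \<forall>y\<in>V. f (x + y) = f x + f y) \<and> (\<forall>c. \<forall>x\<in>V. f (scale c x) = cnj c * f x)"

definition bounded_form ::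
  "'v set \<Rightarrow> ('v \<Rightarrow> 'v \<Rightarrow> complex) \<Rightarrow> ('v \<Rightarrow> complex) \<Rightarrow> bool" where
  "bounded_form V ip f \<longleftrightarrow> (\<exists>K. \<forall>x\<in>V. cmod (f x) \<le> K * cnorm ip x)"

definition sesquilinear ::
  "(complex \<Rightarrow> 'v \<Rightarrow> 'v::ab_group_add) \<Rightarrow> 'v set \<Rightarrow> ('v \<Rightarrow> 'v \<Rightarrow> complex) \<Rightarrow> bool" where
  "sesquilinear scale V a \<longleftrightarrow>
     (\<forall>y\<in>V. linear_form scale V (\<lambda>x. a x y)) \<and> (\<forall>x\<in>V. antilinear_form scale V (a x))"

definition bounded_sesquilinear ::
  "(complex \<Rightarrow> 'v \<Rightarrow> 'v::ab_group_add) \<Rightarrow> 'v set \<Rightarrow> ('v \<Rightarrow> 'v \<Rightarrow> complex) \<Rightarrow>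
    ('v \<Rightarrow> 'v \<Rightarrow> complex) \<Rightarrow> bool" where
  "bounded_sesquilinear scale V ip a \<longleftrightarrow> sesquilinear scale V a \<and>
     (\<exists>K. \<forall>x\<in>V. \<forall>y\<in>V. cmod (a x y) \<le> K * cnorm ip x * cnorm ip y)"

definition infsup ::
  "'v::zero set \<Rightarrow> ('v \<Rightarrow> 'v \<Rightarrow> complex) \<Rightarrow> ('v \<Rightarrow> 'v \<Rightarrow> complex) \<Rightarrow> real" where
  "infsup V ip a =
     (INF x\<in>V - {0}. SUP y\<in>V - {0}. cmod (a x y) / (cnorm ip x * cnorm ip y))"

text \<open>The Riesz isomorphism from the bounded antilinear forms on \<open>V\<close> to \<open>V\<close>.\<close>

definition riesz ::
  "'v set \<Rightarrow> ('v \<Rightarrow> 'v \<Rightarrow> complex) \<Rightarrow> ('v \<Rightarrow> complex) \<Rightarrow> 'v" where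
  "riesz V ip f = (THE g. g \<in> V \<and> (\<forall>v\<in>V. ip g v = f v))"

section \<open>The reduced basis setting\<close>

definition affine_form ::
  "nat \<Rightarrow> (nat \<Rightarrow> 'p \<Rightarrow> complex) \<Rightarrow> (nat \<Rightarrow> 'v \<Rightarrow> 'v \<Rightarrow> complex) \<Rightarrow>
    'p \<Rightarrow> 'v \<Rightarrow> 'v \<Rightarrow> complex" where
  "affine_form d \<alpha> a \<mu> x y = (\<Sum>k<d. \<alpha> k \<mu> * a k x y)"

definition reduced_solution ::
  "(complex \<Rightarrow> 'v \<Rightarrow> 'v::ab_group_add) \<Rightarrow> nat \<Rightarrow> (nat \<Rightarrow> 'v) \<Rightarrow>
    (nat \<Rightarrow> 'p \<Rightarrow> complex) \<Rightarrow> 'p \<Rightarrow> 'v" where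
  "reduced_solution scale Nh u \<gamma> \<mu> = (\<Sum>i<Nh. scale (\<gamma> i \<mu>) (u i))"

text \<open>The residual \<open>G\<^sub>\<mu> x\<close> as an element of \<open>V\<close>, for the form \<open>a\<^sub>\<mu>\<close> given as argument.\<close>

definition residual ::
  "'v set \<Rightarrow> ('v \<Rightarrow> 'v \<Rightarrow> complex) \<Rightarrow> ('v \<Rightarrow> 'v \<Rightarrow> complex) \<Rightarrow> ('v \<Rightarrow> complex) \<Rightarrow> 'v \<Rightarrow> 'v"
  where "residual V ip a\<mu> b x = riesz V ip (\<lambda>v. a\<mu> x v - b v)"

text \<open>\<open>galerkin\<close> and \<open>galerkin_unique\<close> say that the reduced solution is the unique solution in the
  span of the reduced basis. Uniqueness has to be assumed: inf-sup stability on \<open>V\<close> does not pass to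
  subspaces.\<close>

locale reduced_basis = cinner_space scale V ip N
  for scale :: "complex \<Rightarrow> 'v \<Rightarrow> 'v::ab_group_add" and V ip N +
  fixes P :: "'p set" and d :: nat and \<alpha> :: "nat \<Rightarrow> 'p \<Rightarrow> complex"
    and a :: "nat \<Rightarrow> 'v \<Rightarrow> 'v \<Rightarrow> complex" and b :: "'v \<Rightarrow> complex"
    and Nh :: nat and u :: "nat \<Rightarrow> 'v" and \<gamma> :: "nat \<Rightarrow> 'p \<Rightarrow> complex"
    and \<beta> :: "'p \<Rightarrow> real"
  assumes forms: "k < d \<Longrightarrow> sesquilinear scale V (a k)"
    and bounded: "\<mu> \<in> P \<Longrightarrow> bounded_sesquilinear scale V ip (affine_form d \<alpha> a \<mu>)"
    and stable: "\<mu> \<in> P \<Longrightarrow> 0 < infsup V ip (affine_form d \<alpha> a \<mu>)"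
    and rhs: "antilinear_form scale V b" "bounded_form V ip b"
    and infsup_bound: "\<mu> \<in> P \<Longrightarrow> 0 < \<beta> \<mu> \<and> \<beta> \<mu> \<le> infsup V ip (affine_form d \<alpha> a \<mu>)"
    and basis: "u ` {..<Nh} \<subseteq> V" "inj_on u {..<Nh}" "independent (u ` {..<Nh})"
    and galerkin: "\<lbrakk>\<mu> \<in> P; j < Nh\<rbrakk> \<Longrightarrow>
      affine_form d \<alpha> a \<mu> (reduced_solution scale Nh u \<gamma> \<mu>) (u j) = b (u j)"
    and galerkin_unique: "\<lbrakk>\<mu> \<in> P; w \<in> span (u ` {..<Nh});
      \<And>j. j < Nh \<Longrightarrow> affine_form d \<alpha> a \<mu> w (u j) = b (u j)\<rbrakk> \<Longrightarrow>
      w = reduced_solution scale Nh u \<gamma> \<mu>"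

section \<open>The vector to be interpolated\<close>

definition sigma :: "nat \<Rightarrow> nat \<Rightarrow> nat" where
  "sigma d Nh = 1 + 2 * (d * Nh) + (d * Nh)\<^sup>2"

text \<open>With indices starting at 0, \<open>I = i + Nh * k\<close> for \<open>i < Nh\<close>, \<open>k < d\<close>.\<close>

definition xhat ::
  "nat \<Rightarrow> (nat \<Rightarrow> 'p \<Rightarrow> complex) \<Rightarrow> (nat \<Rightarrow> 'p \<Rightarrow> complex) \<Rightarrow> 'p \<Rightarrow> nat \<Rightarrow> complex" where
  "xhat Nh \<alpha> \<gamma> \<mu> I = \<alpha> (I div Nh) \<mu> * \<gamma> (I mod Nh) \<mu>"

definition Xhat ::
  "nat \<Rightarrow> nat \<Rightarrow> (nat \<Rightarrow> 'p \<Rightarrow> complex) \<Rightarrow> (nat \<Rightarrow> 'p \<Rightarrow> complex) \<Rightarrow> 'p \<Rightarrow> complex vec" where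
  "Xhat d Nh \<alpha> \<gamma> \<mu> = (let x = xhat Nh \<alpha> \<gamma> \<mu>; n = d * Nh in
     vec_of_list ([1] @ [x I. I \<leftarrow> [0..<n]] @ [cnj (x I). I \<leftarrow> [0..<n]] @
       [cnj (x I) * x J. I \<leftarrow> [0..<n], J \<leftarrow> [0..<n]]))"

section \<open>The empirical interpolation method\<close>

text \<open>\<open>eim_matrix k q m\<close> is \<open>B\<^sup>k\<close>, \<open>eim_rhs k q \<mu>\<close> is \<open>q\<^sup>k(\<mu>)\<close> and \<open>eim_coeff k q m \<mu>\<close> is
  \<open>\<lambda>\<^sup>k(\<mu>)\<close>; \<open>m r\<close> are the selected parameters and \<open>p r\<close> the selected components.\<close>

definition eim_matrix :: "nat \<Rightarrow> (nat \<Rightarrow> 'p \<Rightarrow> complex) \<Rightarrow> (nat \<Rightarrow> 'p) \<Rightarrow> complex mat" where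
  "eim_matrix k q m = mat k k (\<lambda>(i, j). q i (m j))"

definition eim_rhs :: "nat \<Rightarrow> (nat \<Rightarrow> 'p \<Rightarrow> complex) \<Rightarrow> 'p \<Rightarrow> complex vec" where
  "eim_rhs k q \<mu> = vec k (\<lambda>i. q i \<mu>)"

definition eim_coeff ::
  "nat \<Rightarrow> (nat \<Rightarrow> 'p \<Rightarrow> complex) \<Rightarrow> (nat \<Rightarrow> 'p) \<Rightarrow> 'p \<Rightarrow> complex vec" where
  "eim_coeff k q m \<mu> =
     (THE v. v \<in> carrier_vec k \<and> eim_matrix k q m *\<^sub>v v = eim_rhs k q \<mu>)"

text \<open>The component \<open>l\<close> of \<open>(\<delta>\<^sup>k X)(\<mu>)\<close>; for \<open>k = 0\<close> this is \<open>X(\<mu>)\<^sub>l\<close>.\<close>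

definition eim_delta ::
  "('p \<Rightarrow> complex vec) \<Rightarrow> (nat \<Rightarrow> 'p \<Rightarrow> complex) \<Rightarrow> (nat \<Rightarrow> 'p) \<Rightarrow>
    nat \<Rightarrow> nat \<Rightarrow> 'p \<Rightarrow> complex" where
  "eim_delta X q m k l \<mu> = X \<mu> $ l - (\<Sum>r<k. eim_coeff k q m \<mu> $ r * X (m r) $ l)"

text \<open>A run of \<open>s\<close> steps on vectors with \<open>n\<close> components. Step \<open>k\<close> selects \<open>p k\<close> and \<open>m k\<close> and
  defines \<open>q k\<close> from \<open>\<delta>\<^sup>k X\<close>, which only involves \<open>q i\<close> and \<open>m i\<close> for \<open>i < k\<close>. The
  initialisation of the method is the case \<open>k = 0\<close>.\<close>

definition eim_run ::
  "'p set \<Rightarrow> nat \<Rightarrow> ('p \<Rightarrow> complex vec) \<Rightarrow> nat \<Rightarrow>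
    (nat \<Rightarrow> nat) \<Rightarrow> (nat \<Rightarrow> 'p) \<Rightarrow> (nat \<Rightarrow> 'p \<Rightarrow> complex) \<Rightarrow> bool" where
  "eim_run Pt n X s p m q \<longleftrightarrow> (\<forall>k<s.
     is_arg_max (\<lambda>l. MAX \<mu>\<in>Pt. cmod (eim_delta X q m k l \<mu>)) (\<lambda>l. l < n) (p k) \<and>
     is_arg_max (\<lambda>\<mu>. cmod (eim_delta X q m k (p k) \<mu>)) (\<lambda>\<mu>. \<mu> \<in> Pt) (m k) \<and>
     eim_delta X q m k (p k) (m k) \<noteq> 0 \<and>
     (\<forall>\<mu>\<in>Pt. q k \<mu> = eim_delta X q m k (p k) \<mu> / eim_delta X q m k (p k) (m k)))"

locale reduced_basis_eim = reduced_basis scale V ip N P d \<alpha> a b Nh u \<gamma> \<beta>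
  for scale :: "complex \<Rightarrow> 'v \<Rightarrow> 'v::ab_group_add" and V ip N
    and P :: "'p set" and d \<alpha> a b Nh u \<gamma> \<beta> +
  fixes Pt :: "'p set" and s :: nat and p :: "nat \<Rightarrow> nat" and m :: "nat \<Rightarrow> 'p"
    and q :: "nat \<Rightarrow> 'p \<Rightarrow> complex"
  assumes trial: "finite Pt" "Pt \<subseteq> P"
    and steps: "1 < s" "s \<le> sigma d Nh"
    and run: "eim_run Pt (sigma d Nh) (Xhat d Nh \<alpha> \<gamma>) s p m q"

definition snapshot_residual ::
  "(complex \<Rightarrow> 'v \<Rightarrow> 'v::ab_group_add) \<Rightarrow> 'v set \<Rightarrow> ('v \<Rightarrow> 'v \<Rightarrow> complex) \<Rightarrow>
    nat \<Rightarrow> (nat \<Rightarrow> 'p \<Rightarrow> complex) \<Rightarrow> (nat \<Rightarrow> 'v \<Rightarrow> 'v \<Rightarrow> complex) \<Rightarrow> ('v \<Rightarrow> complex) \<Rightarrow>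
    nat \<Rightarrow> (nat \<Rightarrow> 'v) \<Rightarrow> (nat \<Rightarrow> 'p \<Rightarrow> complex) \<Rightarrow> (nat \<Rightarrow> 'p) \<Rightarrow> nat \<Rightarrow> real" where
  "snapshot_residual scale V ip d \<alpha> a b Nh u \<gamma> m r =
     (cnorm ip (residual V ip (affine_form d \<alpha> a (m r)) b
       (reduced_solution scale Nh u \<gamma> (m r))))\<^sup>2"

text \<open>\<open>rt\<close> is the chosen branch of the complex square root and \<open>W r\<close> stands for \<open>V\<^sub>r\<close>.\<close>

definition E4 ::
  "(complex \<Rightarrow> complex) \<Rightarrow> ('p \<Rightarrow> real) \<Rightarrow> nat \<Rightarrow> (nat \<Rightarrow> 'p \<Rightarrow> complex) \<Rightarrow> (nat \<Rightarrow> 'p) \<Rightarrow>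
    (nat \<Rightarrow> real) \<Rightarrow> 'p \<Rightarrow> complex" where
  "E4 rt \<beta> s q m W \<mu> =
     inverse (of_real (\<beta> \<mu>)) * rt (\<Sum>r<s. eim_coeff s q m \<mu> $ r * of_real (W r))"

section \<open>Online computations\<close>

text \<open>Exact complex arithmetic with unit cost. A program is a list of instructions; each appends
  one register, computed from the earlier registers, from a table \<open>D\<close> of precomputed numbers or
  from the complex numbers \<open>z\<close> that represent the parameter. The only built-in constant is 1, so
  that precomputed numbers enter through \<open>D\<close> alone. \<open>Cond i j k l\<close> branches on the comparison of
  real parts. \<open>App f i\<close> applies an elementary function. Division is total (\<open>x / 0 = 0\<close>) and
  registers or entries that do not exist read as 0.\<close>

datatype instr =
    One
  | Data nat
  | Param nat
  | Add nat nat
  | Sub nat nat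
  | Mul nat nat
  | Div nat nat
  | Cnj nat
  | Cond nat nat nat nat
  | App "complex \<Rightarrow> complex" nat

definition entry :: "complex list \<Rightarrow> nat \<Rightarrow> complex" where
  "entry xs i = (if i < length xs then xs ! i else 0)"

primrec instr_val :: "complex list \<Rightarrow> complex list \<Rightarrow> complex list \<Rightarrow> instr \<Rightarrow> complex" where
  "instr_val D z R One = 1"
| "instr_val D z R (Data i) = entry D i"
| "instr_val D z R (Param i) = entry z i"
| "instr_val D z R (Add i j) = entry R i + entry R j"
| "instr_val D z R (Sub i j) = entry R i - entry R j"
| "instr_val D z R (Mul i j) = entry R i * entry R j"
| "instr_val D z R (Div i j) = entry R i / entry R j"
| "instr_val D z R (Cnj i) = cnj (entry R i)"
| "instr_val D z R (Cond i j k l) =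
     (if Re (entry R i) \<le> Re (entry R j) then entry R k else entry R l)"
| "instr_val D z R (App f i) = f (entry R i)"

definition exec :: "complex list \<Rightarrow> complex list \<Rightarrow> instr list \<Rightarrow> complex list" where
  "exec D z prog = fold (\<lambda>I R. R @ [instr_val D z R I]) prog []"

text \<open>\<open>f\<close> can be evaluated on \<open>S\<close> from the table \<open>D\<close> with at most \<open>c\<close> operations; \<open>enc\<close> gives
  the numbers representing a parameter and \<open>F\<close> the elementary functions available.\<close>

definition online_computable ::
  "(complex \<Rightarrow> complex) set \<Rightarrow> ('p \<Rightarrow> complex list) \<Rightarrow> complex list \<Rightarrow> 'p set \<Rightarrow>
    nat \<Rightarrow> ('p \<Rightarrow> complex) \<Rightarrow> bool" where
  "online_computable F enc D S c f \<longleftrightarrow> (\<exists>prog. prog \<noteq> [] \<and> length prog \<le> c \<and>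
     (\<forall>g i. App g i \<in> set prog \<longrightarrow> g \<in> F) \<and>
     (\<forall>\<mu>\<in>S. last (exec D (enc \<mu>) prog) = f \<mu>))"

text \<open>The numbers produced by the offline stage: the reduced matrices and the reduced right-hand
  side, the numbers \<open>V\<^sub>r\<close>, the interpolation matrix, the denominators met by the interpolation
  method, and the vectors \<open>X(\<mu>\<^sub>r)\<close>. The selected components \<open>p r\<close> are natural numbers, which a
  program contains as addresses.\<close>

definition offline_table ::
  "nat \<Rightarrow> (nat \<Rightarrow> 'v \<Rightarrow> 'v \<Rightarrow> complex) \<Rightarrow> ('v \<Rightarrow> complex) \<Rightarrow> nat \<Rightarrow> (nat \<Rightarrow> 'v) \<Rightarrow>
    ('p \<Rightarrow> complex vec) \<Rightarrow> nat \<Rightarrow> (nat \<Rightarrow> nat) \<Rightarrow> (nat \<Rightarrow> 'p) \<Rightarrow> (nat \<Rightarrow> 'p \<Rightarrow> complex) \<Rightarrow>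
    (nat \<Rightarrow> real) \<Rightarrow> complex list" where
  "offline_table d a b Nh u X s p m q W =
     [a k (u i) (u j). k \<leftarrow> [0..<d], i \<leftarrow> [0..<Nh], j \<leftarrow> [0..<Nh]] @
     [b (u j). j \<leftarrow> [0..<Nh]] @
     [of_real (W r). r \<leftarrow> [0..<s]] @
     [eim_matrix s q m $$ (i, j). i \<leftarrow> [0..<s], j \<leftarrow> [0..<s]] @
     [eim_delta X q m k (p k) (m k). k \<leftarrow> [0..<s]] @
     concat [list_of_vec (X (m r)). r \<leftarrow> [0..<s]]"

end

theory Submission
  imports Defs "Jordan_Normal_Form.Determinant"
begin

text \<open>Unique solvability. By the choice of \<open>q\<close>, the residual \<open>\<delta>\<^sup>k X\<close> vanishes at the nodes
  selected before step \<open>k\<close>: the coefficients of the interpolant at the node \<open>m j\<close> are the \<open>j\<close>-th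
  unit vector, because the right-hand side of their system is the \<open>j\<close>-th column of the matrix.
  Hence \<open>q i (m j) = 0\<close> for \<open>j < i\<close>, while \<open>q i (m i) = 1\<close> by normalisation, so the interpolation
  matrix is upper triangular with unit diagonal and has determinant 1 (\<open>det_eim_matrix\<close>). The
  argument is an induction on the step, since unique solvability at step \<open>k\<close> is what makes the
  coefficients used at that step meaningful.

  Online efficiency. For a given parameter, the coefficients \<open>\<alpha>\<close> are computed first. They give the
  reduced matrix of size \<open>Nh\<close>; it is invertible, because the reduced solution is unique and the
  basis independent (\<open>det_galerkin_matrix\<close>), and solving the reduced system yields \<open>\<gamma>\<close>, hence all
  components of \<open>X\<close>. Then the numbers \<open>q 0, q 1, \<dots>\<close> are computed one after the other: \<open>q k\<close> needs
  the component \<open>p k\<close> of \<open>X\<close>, the coefficients of the interpolant of step \<open>k\<close>, which solve a system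
  of size \<open>k\<close> with the right-hand side \<open>q 0, \<dots>, q (k - 1)\<close>, and numbers of the offline table
  (\<open>unif_eim\<close>). After the last step the coefficients of the error formula are available.

  The bound on the cost has to be the same for all spaces, forms and runs of the method. Only its
  existence matters, so no operations are counted. Instead, a family of functions, indexed by
  problems, is called uniformly computable if some number bounds the cost for all indices at once,
  and this notion is shown to be closed under arithmetic, finite sums and products, determinants
  and, by Cramer's rule, the solution of regular linear systems of fixed size. Each of the steps
  above is one application of these closure properties. The size of the systems, the number of
  steps and the number of components of \<open>X\<close> are fixed by \<open>d\<close>, \<open>Nh\<close> and \<open>s\<close>, and no step involves
  a vector of the full space.\<close>

section \<open>Linear systems with nonzero determinant\<close>

lemma ex1_solution_if_det_nonzero:
  fixes A :: "'a::field mat"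
  assumes A: "A \<in> carrier_mat n n" and det: "det A \<noteq> 0" and b: "b \<in> carrier_vec n"
  shows "\<exists>!x. x \<in> carrier_vec n \<and> A *\<^sub>v x = b"
proof (rule ex_ex1I)
  let ?x = "inverse (det A) \<cdot>\<^sub>v (adj_mat A *\<^sub>v b)"
  have adj: "adj_mat A \<in> carrier_mat n n" "A * adj_mat A = det A \<cdot>\<^sub>m 1\<^sub>m n"
    using adj_mat[OF A] by auto
  have "A *\<^sub>v ?x = inverse (det A) \<cdot>\<^sub>v (A *\<^sub>v (adj_mat A *\<^sub>v b))"
    using A adj(1) b by (intro mult_mat_vec) auto
  also have "A *\<^sub>v (adj_mat A *\<^sub>v b) = det A \<cdot>\<^sub>v b"
    using A adj b by (subst assoc_mult_mat_vec[symmetric]) (auto intro!: eq_vecI simp: row_smult)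
  finally have "A *\<^sub>v ?x = b"
    using det by (simp add: smult_smult_assoc)
  moreover have "?x \<in> carrier_vec n"
    using adj(1) b by auto
  ultimately show "\<exists>x. x \<in> carrier_vec n \<and> A *\<^sub>v x = b"
    by blast
next
  fix x y
  assume x: "x \<in> carrier_vec n \<and> A *\<^sub>v x = b" and y: "y \<in> carrier_vec n \<and> A *\<^sub>v y = b"
  then have "A *\<^sub>v (x - y) = 0\<^sub>v n"
    using A b by (simp add: mult_minus_distrib_mat_vec)
  then have "x - y = 0\<^sub>v n"
    using det det_0_iff_vec_prod_zero[OF A] x y by (metis minus_carrier_vec)
  then have "(x - y) $ i = 0" if "i < n" for i
    using that by simp
  then show "x = y"
    using x y by (intro eq_vecI) auto
qed

section \<open>The interpolation matrices\<close>

lemma eim_run_step: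
  assumes "eim_run Pt n X s p m q" "k < s"
  shows "p k < n" "m k \<in> Pt" "eim_delta X q m k (p k) (m k) \<noteq> 0"
    "\<mu> \<in> Pt \<Longrightarrow> q k \<mu> = eim_delta X q m k (p k) \<mu> / eim_delta X q m k (p k) (m k)"
  using assms by (auto simp: eim_run_def is_arg_max_def)

lemma eim_matrix_carrier: "eim_matrix k q m \<in> carrier_mat k k"
  by (simp add: eim_matrix_def)

lemma eim_rhs_carrier: "eim_rhs k q \<mu> \<in> carrier_vec k"
  by (simp add: eim_rhs_def)

lemma eim_coeff_solves:
  assumes "det (eim_matrix k q m) \<noteq> 0"
  shows "eim_coeff k q m \<mu> \<in> carrier_vec k"
    and "eim_matrix k q m *\<^sub>v eim_coeff k q m \<mu> = eim_rhs k q \<mu>"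
  using theI'[OF ex1_solution_if_det_nonzero[OF eim_matrix_carrier assms eim_rhs_carrier, of q \<mu>]]
  by (simp_all add: eim_coeff_def)

text \<open>The interpolant reproduces \<open>X\<close> at a selected node, because column \<open>j\<close> of \<open>B\<^sup>k\<close> is \<open>q\<^sup>k\<close>
  evaluated at the node \<open>m j\<close>.\<close>

lemma eim_coeff_at_node:
  assumes "det (eim_matrix k q m) \<noteq> 0" "j < k"
  shows "eim_coeff k q m (m j) = unit_vec k j"
proof -
  have "eim_matrix k q m *\<^sub>v unit_vec k j = eim_rhs k q (m j)"
    using assms(2) by (auto simp: eim_matrix_def eim_rhs_def)
  then show ?thesis
    using ex1_solution_if_det_nonzero[OF eim_matrix_carrier assms(1) eim_rhs_carrier]
      eim_coeff_solves[OF assms(1)] by (metis unit_vec_carrier)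
qed

lemma eim_delta_at_node:
  assumes "det (eim_matrix k q m) \<noteq> 0" "j < k"
  shows "eim_delta X q m k l (m j) = 0"
proof -
  have "(\<Sum>r<k. eim_coeff k q m (m j) $ r * X (m r) $ l) =
      (\<Sum>r<k. if r = j then X (m j) $ l else 0)"
    using assms by (intro sum.cong) (auto simp: eim_coeff_at_node)
  then show ?thesis
    using assms(2) by (simp add: eim_delta_def)
qed

lemma det_eim_matrix_if_vanishing:
  assumes zero: "\<And>i j. j < i \<Longrightarrow> i < k \<Longrightarrow> q i (m j) = 0" and one: "\<And>i. i < k \<Longrightarrow> q i (m i) = 1"
  shows "det (eim_matrix k q m) = 1"
proof -
  have "upper_triangular (eim_matrix k q m)"
    using zero by (auto simp: eim_matrix_def)
  moreover have "diag_mat (eim_matrix k q m) = replicate k 1"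
    using one by (auto simp: diag_mat_def eim_matrix_def intro!: nth_equalityI)
  moreover have "prod_list (replicate k (1::complex)) = 1"
    by (induction k) simp_all
  ultimately show ?thesis
    using det_upper_triangular[OF _ eim_matrix_carrier, of k q m] by metis
qed

text \<open>The hypothesis of the induction, that \<open>q\<close> vanishes at earlier nodes for all steps below \<open>i\<close>,
  makes \<open>B\<^sup>i\<close> unitriangular. Its coefficients are therefore determined, and \<open>\<delta>\<^sup>i X\<close>, of which \<open>q i\<close>
  is a multiple, vanishes at the nodes before \<open>m i\<close>.\<close>

lemma eim_vanishes_at_earlier_nodes:
  assumes run: "eim_run Pt n X s p m q"
  shows "j < i \<Longrightarrow> i < s \<Longrightarrow> q i (m j) = 0"
proof (induction i arbitrary: j rule: less_induct)
  case (less i)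
  have "det (eim_matrix i q m) = 1"
    using less.IH less.prems by (intro det_eim_matrix_if_vanishing) (auto simp: eim_run_step[OF run])
  then show ?case
    using less.prems by (simp add: eim_run_step[OF run] eim_delta_at_node)
qed

lemma det_eim_matrix:
  assumes run: "eim_run Pt n X s p m q" and "k \<le> s"
  shows "det (eim_matrix k q m) = 1"
  using assms(2) eim_vanishes_at_earlier_nodes[OF run]
  by (intro det_eim_matrix_if_vanishing) (auto simp: eim_run_step[OF run])

section \<open>The reduced system\<close>

text \<open>Rows are indexed by test functions and columns by ansatz functions, so that the reduced system
  has the coefficients of the ansatz as its unknowns and the numbers \<open>b (u j)\<close> as its right-hand side.\<close>

definition galerkin_matrix ::
  "nat \<Rightarrow> nat \<Rightarrow> (nat \<Rightarrow> 'p \<Rightarrow> complex) \<Rightarrow> (nat \<Rightarrow> 'v \<Rightarrow> 'v \<Rightarrow> complex) \<Rightarrow> (nat \<Rightarrow> 'v) \<Rightarrow>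
    'p \<Rightarrow> complex mat" where
  "galerkin_matrix d Nh \<alpha> a u \<mu> = mat Nh Nh (\<lambda>(j, i). \<Sum>k<d. \<alpha> k \<mu> * a k (u i) (u j))"

lemma galerkin_matrix_carrier: "galerkin_matrix d Nh \<alpha> a u \<mu> \<in> carrier_mat Nh Nh"
  by (simp add: galerkin_matrix_def)

context reduced_basis
begin

text \<open>The forms are linear in the first argument only on \<open>V\<close>, hence the partial sums have to be
  followed inside \<open>V\<close>.\<close>

lemma basis_combination:
  assumes "n \<le> Nh"
  shows "(\<Sum>i<n. scale (c i) (u i)) \<in> V"
    and "k < d \<Longrightarrow> y \<in> V \<Longrightarrow>
      a k (\<Sum>i<n. scale (c i) (u i)) y = (\<Sum>i<n. c i * a k (u i) y)"
proof -
  obtain E where E: "span E = V"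
    using dimension by blast
  have u: "scale e (u i) \<in> V" "u i \<in> V" if "i < Nh" for i e
    using basis(1) that E span_scale by blast+
  have V: "(\<Sum>i<n. scale (c i) (u i)) \<in> V" if "n \<le> Nh" for n
    unfolding E[symmetric] by (rule span_sum) (use u E that in auto)
  then show "(\<Sum>i<n. scale (c i) (u i)) \<in> V"
    using assms .
  show "a k (\<Sum>i<n. scale (c i) (u i)) y = (\<Sum>i<n. c i * a k (u i) y)"
    if k: "k < d" "y \<in> V"
    using assms
  proof (induction n)
    have lin: "linear_form scale V (\<lambda>x. a k x y)"
      using forms[OF k(1)] k(2) by (simp add: sesquilinear_def)
    case 0
    have "0 \<in> V"
      using E span_zero by blast
    then have "a k (scale 0 0) y = 0 * a k 0 y"
      using lin unfolding linear_form_def by blast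
    then show ?case
      by simp
  next
    have lin: "linear_form scale V (\<lambda>x. a k x y)"
      using forms[OF k(1)] k(2) by (simp add: sesquilinear_def)
    case (Suc n)
    then show ?case
      using lin u[of n] V[of n] by (simp add: linear_form_def)
  qed
qed

lemma galerkin_matrix_mult:
  assumes j: "j < Nh"
  shows "(galerkin_matrix d Nh \<alpha> a u \<mu> *\<^sub>v vec Nh c) $ j =
    affine_form d \<alpha> a \<mu> (\<Sum>i<Nh. scale (c i) (u i)) (u j)"
proof -
  have "u j \<in> V"
    using basis(1) j by blast
  then have "affine_form d \<alpha> a \<mu> (\<Sum>i<Nh. scale (c i) (u i)) (u j) =
      (\<Sum>k<d. \<Sum>i<Nh. \<alpha> k \<mu> * a k (u i) (u j) * c i)"
    by (simp add: affine_form_def basis_combination sum_distrib_left mult_ac)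
  also have "\<dots> = (\<Sum>i<Nh. (\<Sum>k<d. \<alpha> k \<mu> * a k (u i) (u j)) * c i)"
    by (subst sum.swap) (simp add: sum_distrib_right)
  finally show ?thesis
    using j by (simp add: galerkin_matrix_def scalar_prod_def atLeast0LessThan)
qed

lemma galerkin_system:
  assumes "\<mu> \<in> P"
  shows "galerkin_matrix d Nh \<alpha> a u \<mu> *\<^sub>v vec Nh (\<lambda>i. \<gamma> i \<mu>) = vec Nh (\<lambda>j. b (u j))"
proof (rule eq_vecI)
  fix j
  assume "j < dim_vec (vec Nh (\<lambda>j. b (u j)))"
  then show "(galerkin_matrix d Nh \<alpha> a u \<mu> *\<^sub>v vec Nh (\<lambda>i. \<gamma> i \<mu>)) $ j = vec Nh (\<lambda>j. b (u j)) $ j"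
    using galerkin[OF assms] by (simp add: galerkin_matrix_mult reduced_solution_def)
qed (simp add: galerkin_matrix_def)

lemma basis_coefficients_unique:
  assumes "(\<Sum>i<Nh. scale (c i) (u i)) = (\<Sum>i<Nh. scale (e i) (u i))" and i: "i < Nh"
  shows "c i = e i"
proof -
  have "(\<Sum>i<Nh. scale (c i - e i) (u i)) = 0"
    using assms by (simp add: scale_left_diff_distrib sum_subtractf)
  \<comment> \<open>independence speaks of coefficients that are indexed by the basis vectors themselves\<close>
  then have "(\<Sum>v\<in>u ` {..<Nh}. scale ((\<lambda>v. c (the_inv_into {..<Nh} u v) - e (the_inv_into {..<Nh} u v)) v) v) = 0"
    by (simp add: sum.reindex basis(2) the_inv_into_f_f)
  from independentD[OF basis(3) _ _ this, of "u i"] i show ?thesis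
    by (simp add: basis(2) the_inv_into_f_f)
qed

text \<open>Adding a kernel vector of the matrix to the coefficients of the reduced solution gives another
  solution of the reduced problem in the span of the basis. Uniqueness of the reduced solution and
  independence of the basis force the kernel vector to be zero.\<close>

lemma det_galerkin_matrix:
  assumes \<mu>: "\<mu> \<in> P"
  shows "det (galerkin_matrix d Nh \<alpha> a u \<mu>) \<noteq> 0"
proof
  assume "det (galerkin_matrix d Nh \<alpha> a u \<mu>) = 0"
  from iffD1[OF det_0_iff_vec_prod_zero[OF galerkin_matrix_carrier] this]
  obtain v where v: "v \<in> carrier_vec Nh" "v \<noteq> 0\<^sub>v Nh" "galerkin_matrix d Nh \<alpha> a u \<mu> *\<^sub>v v = 0\<^sub>v Nh"
    by blast
  define c where "c i = \<gamma> i \<mu> + v $ i" for i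
  let ?w = "\<Sum>i<Nh. scale (c i) (u i)"
  have "vec Nh c = vec Nh (\<lambda>i. \<gamma> i \<mu>) + v"
    using v(1) by (auto simp: c_def)
  then have "galerkin_matrix d Nh \<alpha> a u \<mu> *\<^sub>v vec Nh c = vec Nh (\<lambda>j. b (u j))"
    using v galerkin_system[OF \<mu>]
    by (simp add: mult_add_distrib_mat_vec[OF galerkin_matrix_carrier vec_carrier])
  then have "affine_form d \<alpha> a \<mu> ?w (u j) = b (u j)" if "j < Nh" for j
    using galerkin_matrix_mult[OF that, of \<mu> c] that by simp
  moreover have "?w \<in> span (u ` {..<Nh})"
    by (intro span_sum span_scale span_base) auto
  ultimately have "?w = reduced_solution scale Nh u \<gamma> \<mu>"
    using galerkin_unique[OF \<mu>] by blast
  then have "c i = \<gamma> i \<mu>" if "i < Nh" for i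
    using basis_coefficients_unique[OF _ that] by (simp add: reduced_solution_def)
  then have "v = 0\<^sub>v Nh"
    using v(1) by (intro eq_vecI) (auto simp: c_def)
  with v(2) show False ..
qed

end

section \<open>Composition of online programs\<close>

text \<open>The instruction that has the same effect after \<open>r\<close> registers and \<open>t\<close> table entries have been put
  in front. Registers and entries that do not exist read as 0 and still do so after the shift, so
  that the shift is faithful for every program.\<close>

primrec relocate :: "nat \<Rightarrow> nat \<Rightarrow> instr \<Rightarrow> instr" where
  "relocate r t One = One"
| "relocate r t (Data i) = Data (i + t)"
| "relocate r t (Param i) = Param i"
| "relocate r t (Add i j) = Add (i + r) (j + r)"
| "relocate r t (Sub i j) = Sub (i + r) (j + r)"
| "relocate r t (Mul i j) = Mul (i + r) (j + r)"
| "relocate r t (Div i j) = Div (i + r) (j + r)"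
| "relocate r t (Cnj i) = Cnj (i + r)"
| "relocate r t (Cond i j k l) = Cond (i + r) (j + r) (k + r) (l + r)"
| "relocate r t (App f i) = App f (i + r)"

lemma entry_append: "entry (xs @ ys) (i + length xs) = entry ys i"
  by (simp add: entry_def nth_append)

lemma instr_val_relocate:
  "instr_val (D0 @ D) z (R0 @ R) (relocate (length R0) (length D0) I) = instr_val D z R I"
  by (cases I) (simp_all add: entry_append)

lemma relocate_eq_App: "App f i = relocate r t J \<Longrightarrow> \<exists>j. J = App f j"
  by (cases J) auto

text \<open>The definition of \<open>exec\<close> starts from an empty register file; running one program after another
  requires a start from arbitrary registers.\<close>

definition exec_from :: "complex list \<Rightarrow> complex list \<Rightarrow> instr list \<Rightarrow> complex list \<Rightarrow> complex list" where
  "exec_from D z prog R = fold (\<lambda>I R. R @ [instr_val D z R I]) prog R"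

lemma exec_eq_exec_from: "exec D z prog = exec_from D z prog []"
  by (simp add: exec_def exec_from_def)

lemma exec_from_append: "exec_from D z (prog @ prog') R = exec_from D z prog' (exec_from D z prog R)"
  by (simp add: exec_from_def)

text \<open>A program runs undisturbed behind existing registers and table entries. The registers \<open>R0\<close> come
  from a preceding program, the entries \<open>D0\<close> from a table that is extended to the left.\<close>

lemma exec_from_relocate:
  "exec_from (D0 @ D) z (map (relocate (length R0) (length D0)) prog) (R0 @ R) =
    R0 @ exec_from D z prog R"
  by (induction prog arbitrary: R) (simp_all add: exec_from_def instr_val_relocate)

lemma length_exec_from: "length (exec_from D z prog R) = length R + length prog"
  by (induction prog arbitrary: R) (simp_all add: exec_from_def)

lemma last_eq_entry: "xs \<noteq> [] \<Longrightarrow> last xs = entry xs (length xs - 1)"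
  by (simp add: entry_def last_conv_nth)

lemma online_computable_extend_table:
  assumes "online_computable F enc D S c f" "S' \<subseteq> S"
  shows "online_computable F enc (D0 @ D) S' c f"
proof -
  obtain prog where prog: "prog \<noteq> []" "length prog \<le> c" "\<forall>g i. App g i \<in> set prog \<longrightarrow> g \<in> F"
    "\<forall>\<mu>\<in>S. last (exec D (enc \<mu>) prog) = f \<mu>"
    using assms(1) unfolding online_computable_def by blast
  let ?prog = "map (relocate 0 (length D0)) prog"
  have "exec (D0 @ D) z ?prog = exec D z prog" for z
    using exec_from_relocate[of D0 D z "[]" prog "[]"] by (simp add: exec_eq_exec_from)
  then show ?thesis
    unfolding online_computable_def using prog assms(2)
    by (intro exI[of _ ?prog]) (auto dest!: relocate_eq_App)
qed

lemma online_computable_mono: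
  "online_computable F enc D S c f \<Longrightarrow> c \<le> c' \<Longrightarrow> (\<And>\<mu>. \<mu> \<in> S \<Longrightarrow> f \<mu> = g \<mu>) \<Longrightarrow>
    online_computable F enc D S c' g"
  unfolding online_computable_def by (metis order_trans)

lemma online_computable_instr:
  assumes "\<And>z R. instr_val D z R J = x" "\<And>f k. J = App f k \<Longrightarrow> f \<in> F"
  shows "online_computable F enc D S 1 (\<lambda>\<mu>. x)"
  unfolding online_computable_def using assms
  by (intro exI[of _ "[J]"]) (auto simp: exec_def)

text \<open>The two programs are concatenated, and one further instruction is applied to the last registers
  of each. Unary operations are covered by an instruction that ignores its second argument.\<close>

lemma online_computable_binary:
  assumes f: "online_computable F enc D S c f" and g: "online_computable F enc D S c' g"
    and op: "\<And>z R i j. instr_val D z R (J i j) = h (entry R i) (entry R j)"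
    and App: "\<And>i j f k. J i j = App f k \<Longrightarrow> f \<in> F"
  shows "online_computable F enc D S (c + c' + 1) (\<lambda>\<mu>. h (f \<mu>) (g \<mu>))"
proof -
  obtain P1 where P1: "P1 \<noteq> []" "length P1 \<le> c" "\<forall>g i. App g i \<in> set P1 \<longrightarrow> g \<in> F"
    "\<forall>\<mu>\<in>S. last (exec D (enc \<mu>) P1) = f \<mu>"
    using f unfolding online_computable_def by blast
  obtain P2 where P2: "P2 \<noteq> []" "length P2 \<le> c'" "\<forall>g i. App g i \<in> set P2 \<longrightarrow> g \<in> F"
    "\<forall>\<mu>\<in>S. last (exec D (enc \<mu>) P2) = g \<mu>"
    using g unfolding online_computable_def by blast
  let ?J = "J (length P1 - 1) (length P1 + length P2 - 1)"
  let ?prog = "P1 @ map (relocate (length P1) 0) P2 @ [?J]"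
  have "last (exec D z ?prog) = h (last (exec D z P1)) (last (exec D z P2))" for z
  proof -
    let ?R1 = "exec D z P1" and ?R2 = "exec D z P2"
    have len: "length ?R1 = length P1" "length ?R2 = length P2"
      by (simp_all add: exec_eq_exec_from length_exec_from)
    then have ne: "?R1 \<noteq> []" "?R2 \<noteq> []"
      using P1(1) P2(1) by auto
    have "exec_from D z (map (relocate (length P1) 0) P2) ?R1 = ?R1 @ ?R2"
      using exec_from_relocate[of "[]" D z ?R1 P2 "[]"] len by (simp add: exec_eq_exec_from)
    then have "exec D z ?prog = (?R1 @ ?R2) @ [instr_val D z (?R1 @ ?R2) ?J]"
      by (simp add: exec_eq_exec_from exec_from_append) (simp add: exec_from_def)
    then have "last (exec D z ?prog) =
        h (entry (?R1 @ ?R2) (length P1 - 1)) (entry (?R1 @ ?R2) (length P1 + length P2 - 1))"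
      by (simp add: op)
    also have "entry (?R1 @ ?R2) (length P1 - 1) = last ?R1"
      using ne(1) len by (cases P1) (auto simp: last_eq_entry entry_def nth_append)
    also have "entry (?R1 @ ?R2) (length P1 + length P2 - 1) = last ?R2"
      using ne P2(1) len last_eq_entry[of "?R1 @ ?R2"] by simp
    finally show ?thesis .
  qed
  then show ?thesis
    unfolding online_computable_def using P1 P2 App
    by (intro exI[of _ ?prog]) (auto dest!: relocate_eq_App dest: sym)
qed

section \<open>Families of online computations with a common bound on the cost\<close>

text \<open>The index \<open>i\<close> stands for a whole problem instance. In the predicate below, the order of the
  quantifiers is the point: the bound on the cost is chosen before the instance, the program
  after it.\<close>

locale online_family =
  fixes I :: "'i set" and F :: "'i \<Rightarrow> (complex \<Rightarrow> complex) set"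
    and enc :: "'i \<Rightarrow> 'p \<Rightarrow> complex list" and D :: "'i \<Rightarrow> complex list" and S :: "'i \<Rightarrow> 'p set"
begin

definition uniformly_computable :: "('i \<Rightarrow> 'p \<Rightarrow> complex) \<Rightarrow> bool" where
  "uniformly_computable f \<longleftrightarrow> (\<exists>C. \<forall>i\<in>I. online_computable (F i) (enc i) (D i) (S i) C (f i))"

lemma unif_cong:
  "uniformly_computable f \<Longrightarrow> (\<And>i \<mu>. i \<in> I \<Longrightarrow> \<mu> \<in> S i \<Longrightarrow> f i \<mu> = g i \<mu>) \<Longrightarrow> uniformly_computable g"
  unfolding uniformly_computable_def by (meson online_computable_mono order_refl)

lemma unif_binary:
  assumes "uniformly_computable f" "uniformly_computable g"
    and op: "\<And>i z R j k. i \<in> I \<Longrightarrow> instr_val (D i) z R (J i j k) = h i (entry R j) (entry R k)"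
    and App: "\<And>i j k f l. i \<in> I \<Longrightarrow> J i j k = App f l \<Longrightarrow> f \<in> F i"
  shows "uniformly_computable (\<lambda>i \<mu>. h i (f i \<mu>) (g i \<mu>))"
proof -
  obtain c c' where
    "\<And>i. i \<in> I \<Longrightarrow> online_computable (F i) (enc i) (D i) (S i) c (f i)"
    "\<And>i. i \<in> I \<Longrightarrow> online_computable (F i) (enc i) (D i) (S i) c' (g i)"
    using assms(1,2) unfolding uniformly_computable_def by blast
  then have "online_computable (F i) (enc i) (D i) (S i) (c + c' + 1) (\<lambda>\<mu>. h i (f i \<mu>) (g i \<mu>))"
    if "i \<in> I" for i
    using that op App by (intro online_computable_binary[where J = "J i"]) auto
  then show ?thesis
    unfolding uniformly_computable_def by blast
qed

lemma unif_add:
  "uniformly_computable f \<Longrightarrow> uniformly_computable g \<Longrightarrow>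
    uniformly_computable (\<lambda>i \<mu>. f i \<mu> + g i \<mu>)"
  by (rule unif_binary[where J = "\<lambda>_. Add"]) auto

lemma unif_diff:
  "uniformly_computable f \<Longrightarrow> uniformly_computable g \<Longrightarrow>
    uniformly_computable (\<lambda>i \<mu>. f i \<mu> - g i \<mu>)"
  by (rule unif_binary[where J = "\<lambda>_. Sub"]) auto

lemma unif_mult:
  "uniformly_computable f \<Longrightarrow> uniformly_computable g \<Longrightarrow>
    uniformly_computable (\<lambda>i \<mu>. f i \<mu> * g i \<mu>)"
  by (rule unif_binary[where J = "\<lambda>_. Mul"]) auto

lemma unif_divide:
  "uniformly_computable f \<Longrightarrow> uniformly_computable g \<Longrightarrow>
    uniformly_computable (\<lambda>i \<mu>. f i \<mu> / g i \<mu>)"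
  by (rule unif_binary[where J = "\<lambda>_. Div"]) auto

lemma unif_cnj: "uniformly_computable f \<Longrightarrow> uniformly_computable (\<lambda>i \<mu>. cnj (f i \<mu>))"
  by (rule unif_binary[where J = "\<lambda>_ j _. Cnj j" and h = "\<lambda>_ x _. cnj x"]) auto

lemma unif_apply: "uniformly_computable f \<Longrightarrow> (\<And>i. i \<in> I \<Longrightarrow> h i \<in> F i) \<Longrightarrow> uniformly_computable (\<lambda>i \<mu>. h i (f i \<mu>))"
  by (rule unif_binary[where J = "\<lambda>i j _. App (h i) j" and h = "\<lambda>i x _. h i x"]) auto

lemma unif_one: "uniformly_computable (\<lambda>i \<mu>. 1)"
  unfolding uniformly_computable_def by (intro exI[of _ 1] ballI online_computable_instr[where J = One]) auto

lemma unif_zero: "uniformly_computable (\<lambda>i \<mu>. 0)"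
  using unif_diff[OF unif_one unif_one] by simp

text \<open>A single instruction reads a number from the table wherever it is stored; the address is part of
  the program and may depend on the instance.\<close>

lemma unif_table:
  assumes "\<And>i. i \<in> I \<Longrightarrow> x i \<in> set (D i)"
  shows "uniformly_computable (\<lambda>i \<mu>. x i)"
proof -
  have "online_computable (F i) (enc i) (D i) (S i) 1 (\<lambda>\<mu>. x i)" if i: "i \<in> I" for i
  proof -
    obtain j where "j < length (D i)" "D i ! j = x i"
      using assms[OF i] by (auto simp: in_set_conv_nth)
    then show ?thesis
      by (intro online_computable_instr[where J = "Data j"]) (auto simp: entry_def)
  qed
  then show ?thesis
    unfolding uniformly_computable_def by blast
qed

text \<open>Among finitely many uniformly computable families, one may be chosen for each instance: the sum
  of their bounds serves for every choice. This is needed for the component of \<open>X\<close> that the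
  interpolation method selects, which varies with the instance.\<close>

lemma unif_select:
  fixes n :: nat
  assumes "\<And>l. l < n \<Longrightarrow> uniformly_computable (f l)" and p: "\<And>i. i \<in> I \<Longrightarrow> p i < n"
  shows "uniformly_computable (\<lambda>i. f (p i) i)"
proof -
  have "\<exists>C. \<forall>l<n. \<forall>i\<in>I. online_computable (F i) (enc i) (D i) (S i) (C l) (f l i)"
    using assms(1) unfolding uniformly_computable_def by (intro choice) blast
  then obtain C where
    C: "\<And>l i. l < n \<Longrightarrow> i \<in> I \<Longrightarrow> online_computable (F i) (enc i) (D i) (S i) (C l) (f l i)"
    by blast
  have "online_computable (F i) (enc i) (D i) (S i) (\<Sum>l<n. C l) (f (p i) i)" if "i \<in> I" for i
    by (rule online_computable_mono[OF C]) (use p[OF that] that in \<open>auto intro!: member_le_sum[of _ "{..<n}" C]\<close>)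
  then show ?thesis
    unfolding uniformly_computable_def by blast
qed

lemma unif_sum:
  assumes "finite A" "\<And>x. x \<in> A \<Longrightarrow> uniformly_computable (f x)"
  shows "uniformly_computable (\<lambda>i \<mu>. \<Sum>x\<in>A. f x i \<mu>)"
  using assms by (induction A rule: finite_induct) (simp_all add: unif_zero unif_add)

lemma unif_prod:
  assumes "finite A" "\<And>x. x \<in> A \<Longrightarrow> uniformly_computable (f x)"
  shows "uniformly_computable (\<lambda>i \<mu>. \<Prod>x\<in>A. f x i \<mu>)"
  using assms by (induction A rule: finite_induct) (simp_all add: unif_one unif_mult)

lemma unif_signof: "uniformly_computable (\<lambda>i \<mu>. signof \<pi>)"
  using unif_one unif_diff[OF unif_zero unif_one] by (simp add: sign_def)

text \<open>The Leibniz formula has a number of operations that depends on \<open>n\<close> only and no case distinctions,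
  in contrast to elimination with pivoting.\<close>

lemma unif_det:
  assumes "\<And>j k. j < n \<Longrightarrow> k < n \<Longrightarrow> uniformly_computable (\<lambda>i \<mu>. A i \<mu> $$ (j, k))"
    and carrier: "\<And>i \<mu>. i \<in> I \<Longrightarrow> \<mu> \<in> S i \<Longrightarrow> A i \<mu> \<in> carrier_mat n n"
  shows "uniformly_computable (\<lambda>i \<mu>. det (A i \<mu>))"
proof -
  let ?Q = "{\<pi>. \<pi> permutes {0..<n}}"
  have "uniformly_computable (\<lambda>i \<mu>. \<Sum>\<pi>\<in>?Q. signof \<pi> * (\<Prod>j = 0..<n. A i \<mu> $$ (j, \<pi> j)))"
    using assms(1)
    by (intro unif_sum unif_mult unif_signof unif_prod finite_permutations)
      (auto dest: permutes_in_image)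
  then show ?thesis
    by (rule unif_cong) (simp add: det_def'[OF carrier])
qed

text \<open>Cramer's rule expresses each component of the solution as a quotient of two determinants.\<close>

lemma unif_linear_system:
  assumes A: "\<And>j k. j < n \<Longrightarrow> k < n \<Longrightarrow> uniformly_computable (\<lambda>i \<mu>. A i \<mu> $$ (j, k))"
    and b: "\<And>j. j < n \<Longrightarrow> uniformly_computable (\<lambda>i \<mu>. b i \<mu> $ j)"
    and sys: "\<And>i \<mu>. i \<in> I \<Longrightarrow> \<mu> \<in> S i \<Longrightarrow> A i \<mu> \<in> carrier_mat n n \<and> det (A i \<mu>) \<noteq> 0 \<and>
      x i \<mu> \<in> carrier_vec n \<and> A i \<mu> *\<^sub>v x i \<mu> = b i \<mu>"
    and r: "r < n"
  shows "uniformly_computable (\<lambda>i \<mu>. x i \<mu> $ r)"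
proof -
  let ?B = "\<lambda>i \<mu>. mat n n (\<lambda>(j, k). if k = r then b i \<mu> $ j else A i \<mu> $$ (j, k))"
  have "uniformly_computable (\<lambda>i \<mu>. det (?B i \<mu>) / det (A i \<mu>))"
  proof (intro unif_divide unif_det[of n])
    fix j k
    assume "j < n" "k < n"
    then show "uniformly_computable (\<lambda>i \<mu>. ?B i \<mu> $$ (j, k))"
      using A b by (cases "k = r") simp_all
  qed (use A sys in auto)
  then show ?thesis
  proof (rule unif_cong)
    fix i \<mu>
    assume "i \<in> I" "\<mu> \<in> S i"
    note s = sys[OF this]
    then have "?B i \<mu> = replace_col (A i \<mu>) (A i \<mu> *\<^sub>v x i \<mu>) r"
      by (auto simp: replace_col_def)
    then show "det (?B i \<mu>) / det (A i \<mu>) = x i \<mu> $ r"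
      using s r cramer_lemma_mat[of "A i \<mu>" n "x i \<mu>" r] by simp
  qed
qed

lemma unif_Xhat:
  assumes al: "\<And>k. k < d \<Longrightarrow> uniformly_computable (\<lambda>i. al i k)" and ga: "\<And>j. j < Nh \<Longrightarrow> uniformly_computable (\<lambda>i. ga i j)"
    and l: "l < sigma d Nh"
  shows "uniformly_computable (\<lambda>i \<mu>. Xhat d Nh (al i) (ga i) \<mu> $ l)"
proof -
  let ?n = "d * Nh"
  let ?x = "\<lambda>K i \<mu>. xhat Nh (al i) (ga i) \<mu> K"
  \<comment> \<open>the components of \<open>Xhat\<close>, as a list of families in place of a vector of numbers\<close>
  define L where "L = [\<lambda>i \<mu>. 1] @ map ?x [0..<?n] @ map (\<lambda>K i \<mu>. cnj (?x K i \<mu>)) [0..<?n] @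
    [(\<lambda>i \<mu>. cnj (?x K i \<mu>) * ?x M i \<mu>). K \<leftarrow> [0..<?n], M \<leftarrow> [0..<?n]]"
  have x: "uniformly_computable (?x K)" if "K < ?n" for K
  proof -
    have "0 < Nh"
      using that by (cases Nh) auto
    then have "K div Nh < d" "K mod Nh < Nh"
      using that by (auto simp: less_mult_imp_div_less)
    then show ?thesis
      unfolding xhat_def by (intro unif_mult al ga)
  qed
  have "uniformly_computable f" if "f \<in> set L" for f
    using that x by (auto simp: L_def intro!: unif_one unif_cnj unif_mult)
  moreover have len: "length L = sigma d Nh"
    by (simp add: L_def sigma_def length_concat comp_def sum_list_triv power2_eq_square)
  ultimately have "uniformly_computable (L ! l)"
    using l by simp
  then show ?thesis
  proof (rule unif_cong)
    fix i \<mu>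
    have "Xhat d Nh (al i) (ga i) \<mu> = vec_of_list (map (\<lambda>f. f i \<mu>) L)"
      by (simp add: Xhat_def L_def Let_def comp_def map_concat)
    then show "(L ! l) i \<mu> = Xhat d Nh (al i) (ga i) \<mu> $ l"
      using l len by (simp add: index_vec_of_list del: vec_of_list_map)
  qed
qed

text \<open>The functions \<open>q k\<close> are followed by strong induction on \<open>k\<close>. By the definition of the method, \<open>q k\<close>
  is a quotient of \<open>\<delta>\<^sup>k X\<close>, whose coefficients solve a system that involves only earlier \<open>q j\<close> on
  the right-hand side and tabulated numbers in the matrix; the snapshots \<open>X (m r)\<close> and the
  denominator are tabulated as well.\<close>

lemma unif_eim:
  assumes X: "\<And>l. l < n \<Longrightarrow> uniformly_computable (\<lambda>i \<mu>. X i \<mu> $ l)"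
    and run: "\<And>i. i \<in> I \<Longrightarrow> eim_run (S i) n (X i) s (p i) (m i) (q i)"
    and mat: "\<And>i j k. i \<in> I \<Longrightarrow> j < s \<Longrightarrow> k < s \<Longrightarrow> q i j (m i k) \<in> set (D i)"
    and den: "\<And>i k. i \<in> I \<Longrightarrow> k < s \<Longrightarrow> eim_delta (X i) (q i) (m i) k (p i k) (m i k) \<in> set (D i)"
    and snap: "\<And>i r l. i \<in> I \<Longrightarrow> r < s \<Longrightarrow> l < n \<Longrightarrow> X i (m i r) $ l \<in> set (D i)"
  shows "k < s \<Longrightarrow> uniformly_computable (\<lambda>i. q i k)"
    and "k \<le> s \<Longrightarrow> r < k \<Longrightarrow> uniformly_computable (\<lambda>i \<mu>. eim_coeff k (q i) (m i) \<mu> $ r)"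
proof -
  have coeff: "uniformly_computable (\<lambda>i \<mu>. eim_coeff k (q i) (m i) \<mu> $ r)"
    if q: "\<And>j. j < k \<Longrightarrow> uniformly_computable (\<lambda>i. q i j)" and k: "k \<le> s" and r: "r < k" for k r
  proof (rule unif_linear_system[OF _ _ _ r])
    fix i \<mu>
    assume i: "i \<in> I"
    then show "eim_matrix k (q i) (m i) \<in> carrier_mat k k \<and> det (eim_matrix k (q i) (m i)) \<noteq> 0 \<and>
      eim_coeff k (q i) (m i) \<mu> \<in> carrier_vec k \<and>
      eim_matrix k (q i) (m i) *\<^sub>v eim_coeff k (q i) (m i) \<mu> = eim_rhs k (q i) \<mu>"
      using det_eim_matrix[OF run[OF i] k] by (simp add: eim_matrix_carrier eim_coeff_solves)
  next
    fix j j'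
    assume "j < k" "j' < k"
    then show "uniformly_computable (\<lambda>i \<mu>. eim_matrix k (q i) (m i) $$ (j, j'))"
      using k mat by (auto simp: eim_matrix_def intro!: unif_table)
  next
    fix j
    assume "j < k"
    then show "uniformly_computable (\<lambda>i \<mu>. eim_rhs k (q i) \<mu> $ j)"
      using q by (simp add: eim_rhs_def)
  qed
  show q: "uniformly_computable (\<lambda>i. q i k)" if "k < s" for k
    using that
  proof (induction k rule: less_induct)
    case (less k)
    have "uniformly_computable (\<lambda>i \<mu>. X i \<mu> $ p i k)"
      using unif_select[where f = "\<lambda>l i \<mu>. X i \<mu> $ l" and p = "\<lambda>i. p i k", OF X]
        eim_run_step(1)[OF run less.prems] by blast
    moreover have "uniformly_computable (\<lambda>i \<mu>. \<Sum>r<k. eim_coeff k (q i) (m i) \<mu> $ r * X i (m i r) $ p i k)"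
      using less eim_run_step(1)[OF run less.prems]
      by (intro unif_sum unif_mult coeff unif_table snap) auto
    moreover have "uniformly_computable (\<lambda>i \<mu>. eim_delta (X i) (q i) (m i) k (p i k) (m i k))"
      using den less.prems by (intro unif_table) auto
    ultimately have "uniformly_computable (\<lambda>i \<mu>. eim_delta (X i) (q i) (m i) k (p i k) \<mu> /
        eim_delta (X i) (q i) (m i) k (p i k) (m i k))"
      by (simp add: eim_delta_def unif_diff unif_divide)
    then show ?case
      by (rule unif_cong) (simp add: eim_run_step(4)[OF run less.prems])
  qed
  show "uniformly_computable (\<lambda>i \<mu>. eim_coeff k (q i) (m i) \<mu> $ r)" if "k \<le> s" "r < k"
    using coeff[OF _ that] q that by simp
qed

end

section \<open>The online stage\<close>

lemma dim_Xhat: "dim_vec (Xhat d Nh \<alpha> \<gamma> \<mu>) = sigma d Nh"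
  by (simp add: Xhat_def Let_def sigma_def length_concat comp_def sum_list_triv power2_eq_square)

lemma offline_table_members:
  fixes d a b Nh u X s p m q W
  defines "D \<equiv> set (offline_table d a b Nh u X s p m q W)"
  shows "k < d \<Longrightarrow> i < Nh \<Longrightarrow> j < Nh \<Longrightarrow> a k (u i) (u j) \<in> D"
    and "j < Nh \<Longrightarrow> b (u j) \<in> D"
    and "r < s \<Longrightarrow> of_real (W r) \<in> D"
    and "r < s \<Longrightarrow> r' < s \<Longrightarrow> q r (m r') \<in> D"
    and "r < s \<Longrightarrow> eim_delta X q m r (p r) (m r) \<in> D"
    and "r < s \<Longrightarrow> l < dim_vec (X (m r)) \<Longrightarrow> X (m r) $ l \<in> D"
proof -
  show "k < d \<Longrightarrow> i < Nh \<Longrightarrow> j < Nh \<Longrightarrow> a k (u i) (u j) \<in> D"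
    unfolding D_def offline_table_def by fastforce
  show "j < Nh \<Longrightarrow> b (u j) \<in> D" "r < s \<Longrightarrow> of_real (W r) \<in> D"
    "r < s \<Longrightarrow> eim_delta X q m r (p r) (m r) \<in> D"
    unfolding D_def offline_table_def by auto
  have "r < s \<Longrightarrow> r' < s \<Longrightarrow> eim_matrix s q m $$ (r, r') \<in> D"
    unfolding D_def offline_table_def by fastforce
  then show "r < s \<Longrightarrow> r' < s \<Longrightarrow> q r (m r') \<in> D"
    by (simp add: eim_matrix_def)
  have "l < dim_vec x \<Longrightarrow> x $ l \<in> set (list_of_vec x)" for x :: "complex vec"
    by (metis list_of_vec_index length_list_of_vec nth_mem)
  then show "r < s \<Longrightarrow> l < dim_vec (X (m r)) \<Longrightarrow> X (m r) $ l \<in> D"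
    unfolding D_def offline_table_def by fastforce
qed

text \<open>The data of the method that vary while \<open>d\<close>, \<open>Nh\<close>, \<open>s\<close> and the costs of \<open>\<alpha>\<close> and \<open>\<beta>\<close> are fixed, bundled
  so that they can serve as the index of a family.\<close>

record ('v, 'p) rb_problem =
  rb_dim :: nat
  rb_scale :: "complex \<Rightarrow> 'v \<Rightarrow> 'v"
  rb_space :: "'v set"
  rb_ip :: "'v \<Rightarrow> 'v \<Rightarrow> complex"
  rb_params :: "'p set"
  rb_coeff :: "nat \<Rightarrow> 'p \<Rightarrow> complex"
  rb_form :: "nat \<Rightarrow> 'v \<Rightarrow> 'v \<Rightarrow> complex"
  rb_rhs :: "'v \<Rightarrow> complex"
  rb_basis :: "nat \<Rightarrow> 'v"
  rb_solution :: "nat \<Rightarrow> 'p \<Rightarrow> complex"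
  rb_infsup :: "'p \<Rightarrow> real"
  rb_trial :: "'p set"
  rb_component :: "nat \<Rightarrow> nat"
  rb_node :: "nat \<Rightarrow> 'p"
  rb_eim :: "nat \<Rightarrow> 'p \<Rightarrow> complex"
  rb_root :: "complex \<Rightarrow> complex"
  rb_functions :: "(complex \<Rightarrow> complex) set"
  rb_code :: "'p \<Rightarrow> complex list"
  rb_constants :: "complex list"

definition rb_problems ::
  "nat \<Rightarrow> nat \<Rightarrow> nat \<Rightarrow> nat \<Rightarrow> nat \<Rightarrow> ('v::ab_group_add, 'p) rb_problem set" where
  "rb_problems d Nh s c\<^sub>\<alpha> c\<^sub>\<beta> = {I.
     reduced_basis_eim (rb_scale I) (rb_space I) (rb_ip I) (rb_dim I) (rb_params I) d (rb_coeff I)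
       (rb_form I) (rb_rhs I) Nh (rb_basis I) (rb_solution I) (rb_infsup I) (rb_trial I) s
       (rb_component I) (rb_node I) (rb_eim I) \<and>
     rb_root I \<in> rb_functions I \<and>
     (\<forall>k<d. online_computable (rb_functions I) (rb_code I) (rb_constants I) (rb_params I) c\<^sub>\<alpha>
       (rb_coeff I k)) \<and>
     online_computable (rb_functions I) (rb_code I) (rb_constants I) (rb_params I) c\<^sub>\<beta>
       (\<lambda>\<mu>. of_real (rb_infsup I \<mu>))}"

definition rb_residual :: "nat \<Rightarrow> nat \<Rightarrow> ('v::ab_group_add, 'p) rb_problem \<Rightarrow> nat \<Rightarrow> real" where
  "rb_residual d Nh I = snapshot_residual (rb_scale I) (rb_space I) (rb_ip I) d (rb_coeff I)
     (rb_form I) (rb_rhs I) Nh (rb_basis I) (rb_solution I) (rb_node I)"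

definition rb_table :: "nat \<Rightarrow> nat \<Rightarrow> nat \<Rightarrow> ('v::ab_group_add, 'p) rb_problem \<Rightarrow> complex list" where
  "rb_table d Nh s I = offline_table d (rb_form I) (rb_rhs I) Nh (rb_basis I)
     (Xhat d Nh (rb_coeff I) (rb_solution I)) s (rb_component I) (rb_node I) (rb_eim I)
     (rb_residual d Nh I) @ rb_constants I"

lemma E4_online_computable_uniformly:
  fixes d Nh s c\<^sub>\<alpha> c\<^sub>\<beta> :: nat
  shows "\<exists>C. \<forall>I\<in>(rb_problems d Nh s c\<^sub>\<alpha> c\<^sub>\<beta> :: ('v::ab_group_add, 'p) rb_problem set).
    online_computable (rb_functions I) (rb_code I) (rb_table d Nh s I) (rb_trial I) C
      (E4 (rb_root I) (rb_infsup I) s (rb_eim I) (rb_node I) (rb_residual d Nh I))"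
proof -
  let ?I = "rb_problems d Nh s c\<^sub>\<alpha> c\<^sub>\<beta> :: ('v, 'p) rb_problem set"
  let ?X = "\<lambda>I. Xhat d Nh (rb_coeff I) (rb_solution I)"
  interpret online_family ?I rb_functions rb_code "rb_table d Nh s" rb_trial .
  have eim: "reduced_basis_eim (rb_scale I) (rb_space I) (rb_ip I) (rb_dim I) (rb_params I) d
      (rb_coeff I) (rb_form I) (rb_rhs I) Nh (rb_basis I) (rb_solution I) (rb_infsup I)
      (rb_trial I) s (rb_component I) (rb_node I) (rb_eim I)" if "I \<in> ?I" for I
    using that by (simp add: rb_problems_def)
  then have rb: "reduced_basis (rb_scale I) (rb_space I) (rb_ip I) (rb_dim I) (rb_params I) d
      (rb_coeff I) (rb_form I) (rb_rhs I) Nh (rb_basis I) (rb_solution I) (rb_infsup I)"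
    if "I \<in> ?I" for I
    using that reduced_basis_eim.axioms(1) by blast
  have trial: "rb_trial I \<subseteq> rb_params I"
    and run: "eim_run (rb_trial I) (sigma d Nh) (?X I) s (rb_component I) (rb_node I) (rb_eim I)"
    if "I \<in> ?I" for I
    using reduced_basis_eim.trial(2)[OF eim[OF that]] reduced_basis_eim.run[OF eim[OF that]] by auto
  have table: "x \<in> set (rb_table d Nh s I)"
    if "x \<in> set (offline_table d (rb_form I) (rb_rhs I) Nh (rb_basis I) (?X I) s (rb_component I)
      (rb_node I) (rb_eim I) (rb_residual d Nh I))" for x I
    using that by (simp add: rb_table_def)
  have coeff: "uniformly_computable (\<lambda>I. rb_coeff I k)" if "k < d" for k
    unfolding uniformly_computable_def rb_table_def using that trial
    by (intro exI[of _ "c\<^sub>\<alpha>"] ballI online_computable_extend_table) (auto simp: rb_problems_def)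
  have infsup: "uniformly_computable (\<lambda>I \<mu>. of_real (rb_infsup I \<mu>))"
    unfolding uniformly_computable_def rb_table_def using trial
    by (intro exI[of _ "c\<^sub>\<beta>"] ballI online_computable_extend_table) (auto simp: rb_problems_def)
  let ?G = "\<lambda>I \<mu>. galerkin_matrix d Nh (rb_coeff I) (rb_form I) (rb_basis I) \<mu>"
  have solution: "uniformly_computable (\<lambda>I. rb_solution I j)" if j: "j < Nh" for j
  proof -
    have "uniformly_computable (\<lambda>I \<mu>. vec Nh (\<lambda>i. rb_solution I i \<mu>) $ j)"
    proof (rule unif_linear_system[where A = ?G and b = "\<lambda>I \<mu>. vec Nh (\<lambda>j. rb_rhs I (rb_basis I j))"])
      show "uniformly_computable (\<lambda>I \<mu>. ?G I \<mu> $$ (i, j))" if "i < Nh" "j < Nh" for i j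
        using that
        by (auto simp: galerkin_matrix_def
            intro!: unif_sum unif_mult coeff unif_table table offline_table_members(1))
      show "uniformly_computable (\<lambda>I \<mu>. vec Nh (\<lambda>j. rb_rhs I (rb_basis I j)) $ i)" if "i < Nh" for i
        using that by (auto intro!: unif_table table offline_table_members(2))
    next
      fix I \<mu>
      assume I: "I \<in> ?I" and "\<mu> \<in> rb_trial I"
      then have \<mu>: "\<mu> \<in> rb_params I"
        using trial by blast
      show "?G I \<mu> \<in> carrier_mat Nh Nh \<and> det (?G I \<mu>) \<noteq> 0 \<and>
          vec Nh (\<lambda>i. rb_solution I i \<mu>) \<in> carrier_vec Nh \<and>
          ?G I \<mu> *\<^sub>v vec Nh (\<lambda>i. rb_solution I i \<mu>) = vec Nh (\<lambda>j. rb_rhs I (rb_basis I j))"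
        using reduced_basis.det_galerkin_matrix[OF rb[OF I] \<mu>]
          reduced_basis.galerkin_system[OF rb[OF I] \<mu>] by (simp add: galerkin_matrix_carrier)
    qed (rule j)
    then show ?thesis
      using j by simp
  qed
  have "uniformly_computable (\<lambda>I \<mu>. eim_coeff s (rb_eim I) (rb_node I) \<mu> $ r)" if "r < s" for r
    by (rule unif_eim(2)[where X = ?X and n = "sigma d Nh", OF unif_Xhat[OF coeff solution] run])
      (use that in \<open>auto intro!: table offline_table_members(4-6) simp: dim_Xhat\<close>)
  then have "uniformly_computable (\<lambda>I \<mu>. \<Sum>r<s. eim_coeff s (rb_eim I) (rb_node I) \<mu> $ r * of_real (rb_residual d Nh I r))"
    by (intro unif_sum unif_mult unif_table table offline_table_members(3)) auto
  from unif_apply[where h = rb_root, OF this]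
  have "uniformly_computable (\<lambda>I \<mu>. 1 / of_real (rb_infsup I \<mu>) *
      rb_root I (\<Sum>r<s. eim_coeff s (rb_eim I) (rb_node I) \<mu> $ r * of_real (rb_residual d Nh I r)))"
    by (intro unif_mult[OF unif_divide[OF unif_one infsup]]) (auto simp: rb_problems_def)
  then have "uniformly_computable (\<lambda>I. E4 (rb_root I) (rb_infsup I) s (rb_eim I) (rb_node I) (rb_residual d Nh I))"
    by (rule unif_cong) (simp add: E4_def inverse_eq_divide)
  then show ?thesis
    unfolding uniformly_computable_def .
qed

theorem proposition3p2p1:
  fixes d Nh s c\<^sub>\<alpha> c\<^sub>\<beta> :: nat
  shows "\<exists>C::nat. \<forall>N (scale :: complex \<Rightarrow> 'v \<Rightarrow> 'v::ab_group_add) V ip (P :: 'p set) \<alpha> a b u \<gamma> \<beta>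
      Pt p m q rt F enc T.
    reduced_basis_eim scale V ip N P d \<alpha> a b Nh u \<gamma> \<beta> Pt s p m q \<longrightarrow>
    (\<forall>z. (rt z)\<^sup>2 = z) \<longrightarrow> rt \<in> F \<longrightarrow>
    (\<forall>k<d. online_computable F enc T P c\<^sub>\<alpha> (\<alpha> k)) \<longrightarrow>
    online_computable F enc T P c\<^sub>\<beta> (\<lambda>\<mu>. of_real (\<beta> \<mu>)) \<longrightarrow>
    (let W = snapshot_residual scale V ip d \<alpha> a b Nh u \<gamma> m;
         D = offline_table d a b Nh u (Xhat d Nh \<alpha> \<gamma>) s p m q W @ T
     in (\<forall>\<mu>\<in>Pt. \<exists>!v. v \<in> carrier_vec s \<and> eim_matrix s q m *\<^sub>v v = eim_rhs s q \<mu>) \<and>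
        online_computable F enc D Pt C (E4 rt \<beta> s q m W))"
proof -
  obtain C where C: "\<forall>I\<in>(rb_problems d Nh s c\<^sub>\<alpha> c\<^sub>\<beta> :: ('v, 'p) rb_problem set).
      online_computable (rb_functions I) (rb_code I) (rb_table d Nh s I) (rb_trial I) C
        (E4 (rb_root I) (rb_infsup I) s (rb_eim I) (rb_node I) (rb_residual d Nh I))"
    using E4_online_computable_uniformly ..
  show ?thesis
  proof (intro exI[of _ C] allI impI)
    fix N and scale :: "complex \<Rightarrow> 'v \<Rightarrow> 'v" and V ip and P :: "'p set" and \<alpha> a b u \<gamma> \<beta> Pt p m q
      and rt and F and enc and T
    assume eim: "reduced_basis_eim scale V ip N P d \<alpha> a b Nh u \<gamma> \<beta> Pt s p m q"
      and rt: "\<forall>z. (rt z)\<^sup>2 = z" "rt \<in> F"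
      and \<alpha>: "\<forall>k<d. online_computable F enc T P c\<^sub>\<alpha> (\<alpha> k)"
      and \<beta>: "online_computable F enc T P c\<^sub>\<beta> (\<lambda>\<mu>. of_real (\<beta> \<mu>))"
    let ?I = "\<lparr>rb_dim = N, rb_scale = scale, rb_space = V, rb_ip = ip, rb_params = P, rb_coeff = \<alpha>,
      rb_form = a, rb_rhs = b, rb_basis = u, rb_solution = \<gamma>, rb_infsup = \<beta>, rb_trial = Pt,
      rb_component = p, rb_node = m, rb_eim = q, rb_root = rt, rb_functions = F, rb_code = enc,
      rb_constants = T\<rparr>"
    have "?I \<in> rb_problems d Nh s c\<^sub>\<alpha> c\<^sub>\<beta>"
      using eim rt \<alpha> \<beta> by (simp add: rb_problems_def)
    from bspec[OF C this] have "online_computable F enc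
        (offline_table d a b Nh u (Xhat d Nh \<alpha> \<gamma>) s p m q
          (snapshot_residual scale V ip d \<alpha> a b Nh u \<gamma> m) @ T) Pt C
        (E4 rt \<beta> s q m (snapshot_residual scale V ip d \<alpha> a b Nh u \<gamma> m))"
      by (simp add: rb_table_def rb_residual_def)
    moreover have "det (eim_matrix s q m) \<noteq> 0"
      using det_eim_matrix[OF reduced_basis_eim.run[OF eim] order_refl] by simp
    then have "\<exists>!v. v \<in> carrier_vec s \<and> eim_matrix s q m *\<^sub>v v = eim_rhs s q \<mu>" for \<mu>
      by (rule ex1_solution_if_det_nonzero[OF eim_matrix_carrier _ eim_rhs_carrier])
    ultimately show "let W = snapshot_residual scale V ip d \<alpha> a b Nh u \<gamma> m;
         D = offline_table d a b Nh u (Xhat d Nh \<alpha> \<gamma>) s p m q W @ T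
       in (\<forall>\<mu>\<in>Pt. \<exists>!v. v \<in> carrier_vec s \<and> eim_matrix s q m *\<^sub>v v = eim_rhs s q \<mu>) \<and>
          online_computable F enc D Pt C (E4 rt \<beta> s q m W)"
      unfolding Let_def by blast
  qed
qed

end
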